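(* Let $\boldsymbol{A}\in\mathbb{R}^{m\times n}$ be the weighted polynomial design matrix defined in the context ($m>n$, $\boldsymbol{A}$ of full rank $n$). Let $\boldsymbol{A}^T\boldsymbol{P}=\boldsymbol{Q}\,(\boldsymbol{R}_1\ \ \boldsymbol{R}_2)$ be a column-pivoted QR factorization of $\boldsymbol{A}^T$ as described in the context, and let $\boldsymbol{A}_\boxtimes\in\mathbb{R}^{n\times n}$ be the corresponding row-subselected square submatrix of $\boldsymbol{A}$. Let $\delta>1$ be a constant for which the factorization satisfies $$\sigma_i(\boldsymbol{R}_1)\ \ge\ \frac{\sigma_i(\boldsymbol{A})}{\sqrt{1+\delta^2 n(m-n)}},\qquad 1\le i\le n.$$ Let $\boldsymbol{A}_\ddagger\in\mathbb{R}^{n\times l}$, $1\le l\le n$, be a column-pruned version of $\boldsymbol{A}_\boxtimes$, i.e. the submatrix of $\boldsymbol{A}_\boxtimes$ formed by the columns indexed by a subset $\mathcal{I}\subseteq\mathcal{J}$ with $|\mathcal{I}|=l$ (regardless of how this subset is chosen). Then $$\kappa(\boldsymbol{A}_\ddagger)\ \le\ \kappa(\boldsymbol{A}_\boxtimes)\ \le\ \kappa(\boldsymbol{A})\,\sqrt{1+\delta^2 n(m-n)}.$$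
   Context: Singular values: for a real matrix $\boldsymbol{D}$ of size $p\times q$ with $p\ge q$, $\sigma_1(\boldsymbol{D})\ge\dots\ge\sigma_q(\boldsymbol{D})$ denote its singular values in descending order, and $\kappa(\boldsymbol{D})=\sigma_1(\boldsymbol{D})/\sigma_q(\boldsymbol{D})$ is its 2-norm condition number. Design matrix: let $\boldsymbol{\rho}(\boldsymbol{\zeta})=\prod_{i=1}^d\rho_i(\zeta^{(i)})$ be a product probability density on $\mathbb{R}^d$. For each $k$ let $\{\psi^{(k)}_j\}_{j\ge0}$ be the univariate polynomials (with $\psi_j^{(k)}$ of degree $j$) orthonormal with respect to $\rho_k$ (assumed to exist), and for $\boldsymbol{j}\in\mathbb{N}_0^d$ set $\boldsymbol{\psi}_{\boldsymbol{j}}(\boldsymbol{\zeta})=\prod_{k=1}^d\psi^{(k)}_{j_k}(\zeta^{(k)})$. Let $\mathcal{J}\subset\mathbb{N}_0^d$ be a finite multi-index set with $|\mathcal{J}|=n$ that, for some maximum degree $k\in\mathbb{N}_0$, is either a total order set $\{\boldsymbol{j}:\sum_i j_i\le k\}$, a hyperbolic cross set $\{\boldsymbol{j}:\prod_i(j_i+1)\le k+1\}$, or a hyperbolic set $\{\boldsymbol{j}:(\sum_i j_i^q)^{1/q}\le k\}$ with $q\in[0.2,1]$. Let $\{(\boldsymbol{\zeta}_i,\omega_i^2)\}_{i=1}^m$ be a tensor-product quadrature rule with nonnegative weights $\omega_i^2$ ($\omega_i\ge0$), $m>n$, that is exact on products of basis elements: $\sum_{i=1}^m\omega_i^2\,\boldsymbol{\psi}_{\boldsymbol{j}}(\boldsymbol{\zeta}_i)\boldsymbol{\psi}_{\boldsymbol{\ell}}(\boldsymbol{\zeta}_i)=\delta_{\boldsymbol{\ell},\boldsymbol{j}}$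 (Kronecker delta) for all $\boldsymbol{j},\boldsymbol{\ell}\in\mathcal{J}$. After fixing an arbitrary linear ordering of $\mathcal{J}$, $\boldsymbol{A}\in\mathbb{R}^{m\times n}$ has entries $\boldsymbol{A}(i,\boldsymbol{j})=\omega_i\boldsymbol{\psi}_{\boldsymbol{j}}(\boldsymbol{\zeta}_i)$, $i=1,\dots,m$, $\boldsymbol{j}\in\mathcal{J}$. Pivoted QR and row subselection: in $\boldsymbol{A}^T\boldsymbol{P}=\boldsymbol{Q}(\boldsymbol{R}_1\ \ \boldsymbol{R}_2)$, $\boldsymbol{P}$ is an $m\times m$ permutation matrix, $\boldsymbol{Q}\in\mathbb{R}^{n\times n}$ is orthogonal, $\boldsymbol{R}_1\in\mathbb{R}^{n\times n}$ is nonsingular upper triangular with positive diagonal entries, and $\boldsymbol{R}_2\in\mathbb{R}^{n\times(m-n)}$. Put $\boldsymbol{\pi}=\boldsymbol{P}^T(1,2,\dots,m)^T$. Then $\boldsymbol{A}_\boxtimes$ is the $n\times n$ matrix whose rows are the rows of $\boldsymbol{A}$ with indices $\boldsymbol{\pi}(1),\dots,\boldsymbol{\pi}(n)$, in this order (equivalently, $\boldsymbol{A}_\boxtimes^T$ consists of the first $n$ columns of $\boldsymbol{A}^T\boldsymbol{P}$). Its columns are indexed by $\mathcal{J}$. *)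

theory Defs
  imports "HOL-Analysis.Analysis" "HOL-Computational_Algebra.Polynomial"
    "Jordan_Normal_Form.Char_Poly" "Jordan_Normal_Form.DL_Rank" "Jordan_Normal_Form.DL_Submatrix"
begin

text \<open>Points of $d$-dimensional space have type \<open>real ^ 'd\<close> and multi-indices have type
  \<open>'d \<Rightarrow> nat\<close>, so \<open>d = CARD('d)\<close>. Design matrices have variable size and use the matrix type of
  \<open>Jordan_Normal_Form\<close>, whose rows and columns are counted from 0. The infix \<open>$\<close> is kept for
  vectors of that library; coordinates of points are written \<open>vec_nth\<close>.\<close>

unbundle no vec_syntax

text \<open>The eigenvalues of \<open>D\<^sup>T D\<close> are real, so its characteristic polynomial splits and
  \<^const>\<open>proots\<close> lists all of them with multiplicity. The list has \<open>dim_col D\<close> entries; it is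
  meant for \<open>dim_col D \<le> dim_row D\<close>.\<close>

definition singular_values :: "real mat \<Rightarrow> real list" where
  "singular_values D =
     rev (sorted_list_of_multiset (image_mset sqrt (proots (char_poly (transpose_mat D * D)))))"

text \<open>Singular values are counted from 1.\<close>

definition singular_value :: "nat \<Rightarrow> real mat \<Rightarrow> real" where
  "singular_value i D = singular_values D ! (i - 1)"

definition cond_number :: "real mat \<Rightarrow> real" where
  "cond_number D = singular_value 1 D / singular_value (dim_col D) D"


definition probability_density :: "'a measure \<Rightarrow> ('a \<Rightarrow> real) \<Rightarrow> bool" where
  "probability_density M f \<longleftrightarrow>
     f \<in> borel_measurable M \<and> (\<forall>x\<in>space M. 0 \<le> f x) \<and> integrable M f \<and> integral\<^sup>L M f = 1"

definition product_density :: "('d::finite \<Rightarrow> real \<Rightarrow> real) \<Rightarrow> real ^ 'd \<Rightarrow> real" where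
  "product_density \<rho> z = (\<Prod>k\<in>UNIV. \<rho> k (vec_nth z k))"

definition orthonormal_polys :: "(real \<Rightarrow> real) \<Rightarrow> (nat \<Rightarrow> real poly) \<Rightarrow> bool" where
  "orthonormal_polys r p \<longleftrightarrow>
     (\<forall>j. degree (p j) = j) \<and>
     (\<forall>i j. integrable lborel (\<lambda>x. poly (p i) x * poly (p j) x * r x) \<and>
            (LINT x|lborel. poly (p i) x * poly (p j) x * r x) = (if i = j then 1 else 0))"

definition tensor_poly ::
    "('d::finite \<Rightarrow> nat \<Rightarrow> real poly) \<Rightarrow> ('d \<Rightarrow> nat) \<Rightarrow> real ^ 'd \<Rightarrow> real" where
  "tensor_poly \<psi> j z = (\<Prod>k\<in>UNIV. poly (\<psi> k (j k)) (vec_nth z k))"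

definition total_order_set :: "nat \<Rightarrow> ('d::finite \<Rightarrow> nat) set" where
  "total_order_set k = {j. (\<Sum>i\<in>UNIV. j i) \<le> k}"

definition hyperbolic_cross_set :: "nat \<Rightarrow> ('d::finite \<Rightarrow> nat) set" where
  "hyperbolic_cross_set k = {j. (\<Prod>i\<in>UNIV. j i + 1) \<le> k + 1}"

text \<open>Note \<open>0 powr q = 0\<close>, as intended for \<open>q > 0\<close>.\<close>

definition hyperbolic_set :: "real \<Rightarrow> nat \<Rightarrow> ('d::finite \<Rightarrow> nat) set" where
  "hyperbolic_set q k = {j. (\<Sum>i\<in>UNIV. real (j i) powr q) powr (1 / q) \<le> real k}"

definition admissible_index_set :: "('d::finite \<Rightarrow> nat) set \<Rightarrow> bool" where
  "admissible_index_set J \<longleftrightarrow>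
     (\<exists>k. J = total_order_set k \<or> J = hyperbolic_cross_set k \<or>
          (\<exists>q. 1 / 5 \<le> q \<and> q \<le> 1 \<and> J = hyperbolic_set q k))"

text \<open>The nodes \<open>z i\<close> and weights \<open>w i\<close>, \<open>i < m\<close>, enumerate (via \<open>g\<close>) the full grid built from
  univariate rules with \<open>N k\<close> nodes \<open>x k\<close> and weights \<open>v k\<close> in direction \<open>k\<close>.\<close>

definition tensor_quadrature ::
    "nat \<Rightarrow> (nat \<Rightarrow> real ^ 'd::finite) \<Rightarrow> (nat \<Rightarrow> real) \<Rightarrow> bool" where
  "tensor_quadrature m z w \<longleftrightarrow>
     (\<exists>(N :: 'd \<Rightarrow> nat) (x :: 'd \<Rightarrow> nat \<Rightarrow> real) (v :: 'd \<Rightarrow> nat \<Rightarrow> real) (g :: nat \<Rightarrow> 'd \<Rightarrow> nat).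
        bij_betw g {..<m} {a. \<forall>k. a k < N k} \<and>
        (\<forall>i<m. \<forall>k. vec_nth (z i) k = x k (g i k)) \<and>
        (\<forall>i<m. w i = (\<Prod>k\<in>UNIV. v k (g i k))))"

text \<open>\<open>e\<close> is the linear ordering of the index set: column \<open>c\<close> belongs to the multi-index \<open>e c\<close>.\<close>

definition design_matrix ::
    "nat \<Rightarrow> nat \<Rightarrow> ('d::finite \<Rightarrow> nat \<Rightarrow> real poly) \<Rightarrow> (nat \<Rightarrow> real ^ 'd) \<Rightarrow> (nat \<Rightarrow> real) \<Rightarrow>
     (nat \<Rightarrow> 'd \<Rightarrow> nat) \<Rightarrow> real mat" where
  "design_matrix m n \<psi> z \<omega> e = Matrix.mat m n (\<lambda>(i, c). \<omega> i * tensor_poly \<psi> (e c) (z i))"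


definition permutation_matrix :: "nat \<Rightarrow> real mat \<Rightarrow> bool" where
  "permutation_matrix m P \<longleftrightarrow>
     (\<exists>p. p permutes {..<m} \<and> P = Matrix.mat m m (\<lambda>(i, j). if i = p j then 1 else 0))"

text \<open>Not \<^const>\<open>orthogonal_mat\<close>, which only asks for orthogonal nonzero columns.\<close>

definition orthogonal_square_mat :: "nat \<Rightarrow> real mat \<Rightarrow> bool" where
  "orthogonal_square_mat n Q \<longleftrightarrow>
     Q \<in> carrier_mat n n \<and> transpose_mat Q * Q = 1\<^sub>m n \<and> Q * transpose_mat Q = 1\<^sub>m n"

text \<open>The block matrix \<open>(R1 R2)\<close>.\<close>

definition append_cols :: "real mat \<Rightarrow> real mat \<Rightarrow> real mat" where
  "append_cols R1 R2 = four_block_mat R1 R2 (0\<^sub>m 0 (dim_col R1)) (0\<^sub>m 0 (dim_col R2))"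

definition pivoted_qr ::
    "nat \<Rightarrow> nat \<Rightarrow> real mat \<Rightarrow> real mat \<Rightarrow> real mat \<Rightarrow> real mat \<Rightarrow> real mat \<Rightarrow> bool" where
  "pivoted_qr m n A P Q R1 R2 \<longleftrightarrow>
     permutation_matrix m P \<and> orthogonal_square_mat n Q \<and>
     R1 \<in> carrier_mat n n \<and> invertible_mat R1 \<and> upper_triangular R1 \<and> (\<forall>i<n. 0 < R1 $$ (i, i)) \<and>
     R2 \<in> carrier_mat n (m - n) \<and>
     transpose_mat A * P = Q * append_cols R1 R2"

text \<open>\<open>\<pi> = P\<^sup>T (1, \<dots>, m)\<^sup>T\<close>, where row \<open>i\<close> (counted from 0) carries the label \<open>i + 1\<close>.\<close>

definition pivot_vector :: "nat \<Rightarrow> real mat \<Rightarrow> (nat \<Rightarrow> nat) \<Rightarrow> bool" where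
  "pivot_vector m P \<pi> \<longleftrightarrow>
     transpose_mat P *\<^sub>v Matrix.vec m (\<lambda>i. real (i + 1)) = Matrix.vec m (\<lambda>i. real (\<pi> i + 1))"

definition row_subselection :: "nat \<Rightarrow> (nat \<Rightarrow> nat) \<Rightarrow> real mat \<Rightarrow> real mat" where
  "row_subselection n \<pi> A = Matrix.mat n (dim_col A) (\<lambda>(i, c). A $$ (\<pi> i, c))"

definition column_pruning ::
    "(nat \<Rightarrow> 'd \<Rightarrow> nat) \<Rightarrow> ('d \<Rightarrow> nat) set \<Rightarrow> real mat \<Rightarrow> real mat" where
  "column_pruning e I B = submatrix B UNIV {c. c < dim_col B \<and> e c \<in> I}"

end

theory Submission
  imports Defs
begin

text \<open>Write \<open>\<sigma>\<^sub>1 D\<close> and \<open>\<sigma>\<^sub>n D\<close> for the largest and the smallest singular value of a matrix \<open>D\<close>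
  with \<open>n\<close> columns. They are the maximum and the minimum of \<open>\<bar>D x\<bar> / \<bar>x\<bar>\<close> over \<open>x \<noteq> 0\<close>
  (\<open>first_singular_value_Rayleigh\<close>, \<open>last_singular_value_Rayleigh\<close>), and both inequalities are
  comparisons of such quotients.

  Passing from the square matrix to its pruned version restricts \<open>x\<close> to the vectors that vanish
  outside the chosen columns. A maximum over fewer vectors is smaller, a minimum over fewer vectors
  is larger, so the condition number cannot grow.

  Passing from \<open>A\<close> to the selected rows deletes entries of \<open>A x\<close>, so \<open>\<sigma>\<^sub>1\<close> of the selection is at
  most \<open>\<sigma>\<^sub>1 A\<close>. For \<open>\<sigma>\<^sub>n\<close> the factorization is needed: the selected rows form the transpose of
  \<open>Q R1\<close> (\<open>row_subselection_pivoted_qr\<close>), and neither transposing an invertible matrix nor multiplying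
  by the orthogonal \<open>Q\<close> changes singular values. So the assumed bound on \<open>\<sigma>\<^sub>n R1\<close> is a lower bound
  \<open>\<sigma>\<^sub>n A / sqrt (\<dots>)\<close> for \<open>\<sigma>\<^sub>n\<close> of the selection, and dividing gives the second inequality. The
  quotients make sense because \<open>R1\<close> is invertible, which makes \<open>\<sigma>\<^sub>n\<close> of the selection positive, and
  \<open>\<sigma>\<^sub>n A\<close> is at least as large since \<open>A x\<close> has more entries.

  The singular values are defined through roots of a characteristic polynomial. The link to the
  quotients is the extremal part of the spectral theorem for a symmetric real matrix: the
  characteristic polynomial splits over the reals, and the extreme eigenvalues are the extreme
  values of the Rayleigh quotient (\<open>symmetric_char_poly_splits\<close>, \<open>symmetric_min_eigenvalue\<close>).\<close>

(* From here on the infix dot is the scalar product of vectors of variable size. *)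
unbundle no inner_syntax

section \<open>Symmetric real matrices\<close>

lemma symmetric_scalar_prod:
  fixes S :: "'a::comm_semiring_0 mat"
  assumes S: "S \<in> carrier_mat n n" and sym: "transpose_mat S = S"
    and x: "x \<in> carrier_vec n" and y: "y \<in> carrier_vec n"
  shows "(S *\<^sub>v x) \<bullet> y = x \<bullet> (S *\<^sub>v y)"
  using transpose_vec_mult_scalar[OF S y x] sym by simp

lemma scalar_prod_self_nonneg: "0 \<le> x \<bullet> (x :: real Matrix.vec)"
  unfolding scalar_prod_def by (rule sum_nonneg) simp

lemma scalar_prod_self_pos:
  fixes x :: "real Matrix.vec"
  assumes "x \<in> carrier_vec n" "x \<noteq> 0\<^sub>v n"
  shows "0 < x \<bullet> x"
proof -
  have "conjugate x = x" by (rule eq_vecI) simp_all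
  then show ?thesis using conjugate_square_greater_0_vec[OF assms(1)] assms(2) by simp
qed

text \<open>For an eigenvector \<open>v\<close> of the complexification \<open>C\<close> of \<open>S\<close>, the number \<open>(C v) \<bullet>c v\<close> is \<open>a\<close> times
  \<open>v \<bullet>c v\<close>. Moving \<open>C\<close> to the other argument, which symmetry allows, it is \<open>cnj a\<close> times \<open>v \<bullet>c v\<close>,
  because \<open>C\<close> has real entries. And \<open>v \<bullet>c v\<close> is not zero.\<close>

lemma symmetric_complex_eigenvalue_real:
  fixes S :: "real mat"
  assumes S: "S \<in> carrier_mat n n" and sym: "transpose_mat S = S"
    and ev: "eigenvalue (map_mat complex_of_real S) a"
  shows "complex_of_real (Re a) = a"
proof -
  let ?C = "map_mat complex_of_real S"
  have C: "?C \<in> carrier_mat n n" using S by simp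
  have symC: "transpose_mat ?C = ?C"
  proof -
    have "transpose_mat ?C = map_mat complex_of_real (transpose_mat S)" by (rule eq_matI) auto
    then show ?thesis by (simp add: sym)
  qed
  obtain v where v: "v \<in> carrier_vec n" "v \<noteq> 0\<^sub>v n" and Cv: "?C *\<^sub>v v = a \<cdot>\<^sub>v v"
    using ev S unfolding eigenvalue_def eigenvector_def by auto
  have "?C *\<^sub>v conjugate v = conjugate (?C *\<^sub>v v)"
    using S v by (intro eq_vecI) (auto simp: scalar_prod_def)
  also have "\<dots> = cnj a \<cdot>\<^sub>v conjugate v" using v unfolding Cv by auto
  finally have Cc: "?C *\<^sub>v conjugate v = cnj a \<cdot>\<^sub>v conjugate v" .
  have "a * (v \<bullet>c v) = (?C *\<^sub>v v) \<bullet> conjugate v" using v unfolding Cv by simp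
  also have "\<dots> = v \<bullet> (?C *\<^sub>v conjugate v)"
    using v by (intro symmetric_scalar_prod[OF C symC]) auto
  also have "\<dots> = cnj a * (v \<bullet>c v)" using v unfolding Cc by simp
  finally have "a = cnj a" using v by simp
  then show ?thesis by (simp add: complex_eq_iff)
qed

text \<open>Over the complex numbers the polynomial splits into linear factors; their roots are eigenvalues,
  hence real, and the factorization descends because the embedding of the reals is injective on
  polynomials.\<close>

lemma symmetric_char_poly_splits:
  fixes S :: "real mat"
  assumes S: "S \<in> carrier_mat n n" and sym: "transpose_mat S = S"
  shows "\<exists>as. length as = n \<and> char_poly S = (\<Prod>a\<leftarrow>as. [:- a, 1:])"
proof -
  let ?C = "map_mat complex_of_real S"
  have C: "?C \<in> carrier_mat n n" using S by simp
  obtain as where as: "char_poly ?C = (\<Prod>a\<leftarrow>as. [:- a, 1:])" "length as = n"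
    using char_poly_factorized[OF C] by blast
  have real: "complex_of_real (Re a) = a" if "a \<in> set as" for a
  proof (rule symmetric_complex_eigenvalue_real[OF S sym])
    show "eigenvalue ?C a"
      using that unfolding eigenvalue_root_char_poly[OF C] as
      by (auto simp: poly_prod_list prod_list_zero_iff)
  qed
  let ?rs = "map Re as"
  interpret h: map_poly_inj_comm_ring_hom complex_of_real ..
  have "map_poly complex_of_real (char_poly S) = (\<Prod>a\<leftarrow>as. [:- a, 1:])"
    by (simp add: of_real_hom.char_poly_hom[OF S, symmetric] as)
  also have "\<dots> = (\<Prod>a\<leftarrow>as. map_poly complex_of_real [:- Re a, 1:])"
    by (rule arg_cong[of _ _ prod_list], rule map_cong) (auto simp: real)
  also have "\<dots> = map_poly complex_of_real (\<Prod>a\<leftarrow>?rs. [:- a, 1:])"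
    by (simp add: h.hom_prod_list o_def)
  finally have "char_poly S = (\<Prod>a\<leftarrow>?rs. [:- a, 1:])" by simp
  then show ?thesis using as(2) by (intro exI[of _ ?rs]) simp
qed

text \<open>Near \<open>t = 0\<close> the linear term dominates and would change sign.\<close>

lemma quadratic_nonneg_linear_coeff_zero:
  fixes b c :: real
  assumes "\<And>t. 0 \<le> 2 * t * b + t\<^sup>2 * c"
  shows "b = 0"
proof (rule ccontr)
  assume b: "b \<noteq> 0"
  \<comment> \<open>The minimizer of \<open>2 * t * b + t\<^sup>2 * (\<bar>c\<bar> + 1)\<close>; the added 1 keeps the division safe when \<open>c = 0\<close>.\<close>
  define t where "t = - b / (\<bar>c\<bar> + 1)"
  have "2 * t * b + t\<^sup>2 * c \<le> 2 * t * b + t\<^sup>2 * (\<bar>c\<bar> + 1)"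
    by (intro add_left_mono mult_left_mono) auto
  also have "\<dots> = - b\<^sup>2 / (\<bar>c\<bar> + 1)"
    unfolding t_def by (simp add: power2_eq_square divide_simps)
  also have "\<dots> < 0" using b by (simp add: divide_neg_pos)
  finally show False using assms[of t] by linarith
qed

text \<open>A quadratic form is continuous and the unit sphere is compact, so a minimum is attained there;
  scaling extends the inequality to all vectors. For the compactness argument vectors are represented
  by functions on all naturals that vanish from \<open>n\<close> on, since these form a topological space.\<close>

lemma min_Rayleigh_quotient_attained:
  fixes S :: "real mat"
  assumes S: "S \<in> carrier_mat n n" and n: "0 < n"
  shows "\<exists>v\<in>carrier_vec n. v \<bullet> v = 1 \<and>
           (\<forall>x\<in>carrier_vec n. (v \<bullet> (S *\<^sub>v v)) * (x \<bullet> x) \<le> x \<bullet> (S *\<^sub>v x))"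
proof -
  define q :: "(nat \<Rightarrow> real) \<Rightarrow> real"
    where "q f = (\<Sum>i<n. f i * (\<Sum>j<n. S $$ (i, j) * f j))" for f
  define B :: "(nat \<Rightarrow> real) set"
    where "B = Pi\<^sub>E UNIV (\<lambda>i. if i < n then {-1..1} else {0})"
  \<comment> \<open>The unit sphere is a closed subset of the cube \<open>B\<close>, which is compact by Tychonoff.\<close>
  define K where "K = B \<inter> {f. (\<Sum>i<n. (f i)\<^sup>2) = 1}"
  have coord: "continuous_on A (\<lambda>f. f i)" for A :: "(nat \<Rightarrow> real) set" and i
    by (rule continuous_on_subset[OF continuous_on_product_coordinates]) simp
  have "compactin (product_topology (\<lambda>_. euclidean) UNIV) B"
    unfolding B_def compactin_PiE by auto
  then have "compact B"
    by (metis compactin_euclidean_iff euclidean_product_topology)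
  moreover have "closed {f::nat \<Rightarrow> real. (\<Sum>i<n. (f i)\<^sup>2) = 1}"
    by (intro closed_Collect_eq continuous_intros coord)
  ultimately have "compact K" unfolding K_def by (rule compact_Int_closed)
  moreover have "(\<lambda>i. if i = 0 then 1 else 0) \<in> K"
    using n by (auto simp: K_def B_def if_distrib[of "\<lambda>x. x^2"] cong: if_cong)
  then have "K \<noteq> {}" by blast
  moreover have "continuous_on K q"
    unfolding q_def by (intro continuous_intros coord)
  ultimately obtain f where f: "f \<in> K" and le: "\<And>g. g \<in> K \<Longrightarrow> q f \<le> q g"
    using continuous_attains_inf[of K q] by blast
  have q: "Matrix.vec n g \<bullet> (S *\<^sub>v Matrix.vec n g) = q g" for g
    using S unfolding q_def by (auto simp: scalar_prod_def atLeast0LessThan intro!: sum.cong)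
  have sq: "Matrix.vec n g \<bullet> Matrix.vec n g = (\<Sum>i<n. (g i)\<^sup>2)" for g :: "nat \<Rightarrow> real"
    by (simp add: scalar_prod_def atLeast0LessThan power2_eq_square)
  let ?v = "Matrix.vec n f"
  have "q f * (x \<bullet> x) \<le> x \<bullet> (S *\<^sub>v x)" if x: "x \<in> carrier_vec n" for x
  proof (cases "x = 0\<^sub>v n")
    case True
    then show ?thesis using S by simp
  next
    case False
    let ?r = "sqrt (x \<bullet> x)"
    have pos: "0 < x \<bullet> x" using scalar_prod_self_pos[OF x False] .
    define g where "g i = (if i < n then x $ i / ?r else 0)" for i
    have xg: "x = ?r \<cdot>\<^sub>v Matrix.vec n g"
      using x pos by (intro eq_vecI) (auto simp: g_def)
    have "x \<bullet> x = ?r\<^sup>2 * (Matrix.vec n g \<bullet> Matrix.vec n g)"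
      by (subst (1 2) xg) (simp add: power2_eq_square)
    then have one: "(\<Sum>i<n. (g i)\<^sup>2) = 1" using pos by (simp add: sq)
    have bd: "- 1 \<le> g i \<and> g i \<le> 1" if "i < n" for i
    proof -
      have "(g i)\<^sup>2 \<le> (\<Sum>i<n. (g i)\<^sup>2)" using that by (intro member_le_sum) auto
      then show ?thesis using one by (simp add: abs_square_le_1 abs_le_iff)
    qed
    have "g \<in> B" unfolding B_def
    proof (rule PiE_I)
      fix i show "g i \<in> (if i < n then {-1..1} else {0})"
        using bd[of i] by (cases "i < n") (auto simp: g_def)
    qed simp
    then have "g \<in> K" using one by (simp add: K_def)
    then have "q f * (x \<bullet> x) \<le> (x \<bullet> x) * q g"
      using le[of g] pos by (simp add: mult.commute)
    also have "\<dots> = ?r * (?r * q g)" using pos by simp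
    also have "\<dots> = x \<bullet> (S *\<^sub>v x)"
      using S by (subst (3 4) xg) (simp add: mult_mat_vec q)
    finally show ?thesis .
  qed
  then show ?thesis using f
    by (intro bexI[of _ ?v]) (auto simp: q sq K_def)
qed

text \<open>At a unit minimizer \<open>v\<close> with value \<open>\<mu>\<close>, the form \<open>x \<bullet> (S x) - \<mu> (x \<bullet> x)\<close> is nonnegative and vanishes
  at \<open>v\<close>, so its derivative at \<open>v\<close> in every direction is zero. The direction of the residual \<open>S v - \<mu> v\<close>
  shows that the residual is zero.\<close>

lemma symmetric_min_eigenvalue:
  fixes S :: "real mat"
  assumes S: "S \<in> carrier_mat n n" and sym: "transpose_mat S = S" and n: "0 < n"
  shows "\<exists>\<mu>. eigenvalue S \<mu> \<and> (\<forall>x\<in>carrier_vec n. \<mu> * (x \<bullet> x) \<le> x \<bullet> (S *\<^sub>v x))"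
proof -
  obtain v where v: "v \<in> carrier_vec n" "v \<bullet> v = 1"
    and min: "\<And>x. x \<in> carrier_vec n \<Longrightarrow> (v \<bullet> (S *\<^sub>v v)) * (x \<bullet> x) \<le> x \<bullet> (S *\<^sub>v x)"
    using min_Rayleigh_quotient_attained[OF S n] by blast
  define \<mu> where "\<mu> = v \<bullet> (S *\<^sub>v v)"
  define r where "r = S *\<^sub>v v - \<mu> \<cdot>\<^sub>v v"
  have Sv: "S *\<^sub>v v \<in> carrier_vec n" and r: "r \<in> carrier_vec n" and Sr: "S *\<^sub>v r \<in> carrier_vec n"
    using S v by (auto simp: r_def)
  have rr: "r \<bullet> r = r \<bullet> (S *\<^sub>v v) - \<mu> * (r \<bullet> v)"
    by (subst (2) r_def) (use r v Sv in \<open>simp add: scalar_prod_minus_distrib\<close>)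
  have comm: "v \<bullet> (S *\<^sub>v r) = r \<bullet> (S *\<^sub>v v)" "v \<bullet> r = r \<bullet> v"
    using symmetric_scalar_prod[OF S sym v(1) r] comm_scalar_prod[OF Sv r]
      comm_scalar_prod[OF v(1) r] by auto
  \<comment> \<open>The derivative of the form at \<open>v\<close> in direction \<open>r\<close> is \<open>2 (r \<bullet> r)\<close>.\<close>
  have "r \<bullet> r = 0"
  proof (rule quadratic_nonneg_linear_coeff_zero)
    fix t
    let ?x = "v + t \<cdot>\<^sub>v r"
    have Sx: "S *\<^sub>v ?x = S *\<^sub>v v + t \<cdot>\<^sub>v (S *\<^sub>v r)"
      using S v r by (simp add: mult_add_distrib_mat_vec mult_mat_vec)
    have xSx: "?x \<bullet> (S *\<^sub>v ?x) = \<mu> + 2 * t * (r \<bullet> (S *\<^sub>v v)) + t\<^sup>2 * (r \<bullet> (S *\<^sub>v r))"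
      unfolding Sx using v(1) r Sv Sr
      by (simp add: add_scalar_prod_distrib[of _ n] scalar_prod_add_distrib[of _ n] comm
          \<mu>_def[symmetric] power2_eq_square algebra_simps)
    have xx: "?x \<bullet> ?x = 1 + 2 * t * (r \<bullet> v) + t\<^sup>2 * (r \<bullet> r)"
      using v r
      by (simp add: add_scalar_prod_distrib[of _ n] scalar_prod_add_distrib[of _ n] comm
          power2_eq_square algebra_simps)
    have "\<mu> * (?x \<bullet> ?x) \<le> ?x \<bullet> (S *\<^sub>v ?x)"
      using min[of ?x] v r by (simp add: \<mu>_def)
    then show "0 \<le> 2 * t * (r \<bullet> r) + t\<^sup>2 * (r \<bullet> (S *\<^sub>v r) - \<mu> * (r \<bullet> r))"
      unfolding xSx xx by (subst rr) (simp add: algebra_simps)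
  qed
  then have "r = 0\<^sub>v n" using scalar_prod_self_pos[OF r] by fastforce
  have "S *\<^sub>v v = \<mu> \<cdot>\<^sub>v v"
  proof (rule eq_vecI)
    fix i assume "i < dim_vec (\<mu> \<cdot>\<^sub>v v)"
    then have "i < n" using v by simp
    then have "r $ i = 0" using \<open>r = 0\<^sub>v n\<close> by simp
    then show "(S *\<^sub>v v) $ i = (\<mu> \<cdot>\<^sub>v v) $ i" using \<open>i < n\<close> v Sv unfolding r_def by simp
  qed (use S v in auto)
  moreover have "v \<noteq> 0\<^sub>v n" using v by auto
  ultimately have "eigenvector S v \<mu>" using v S unfolding eigenvector_def by simp
  then show ?thesis using min unfolding eigenvalue_def \<mu>_def by blast
qed

lemma symmetric_max_eigenvalue:
  fixes S :: "real mat"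
  assumes S: "S \<in> carrier_mat n n" and sym: "transpose_mat S = S" and n: "0 < n"
  shows "\<exists>\<mu>. eigenvalue S \<mu> \<and> (\<forall>x\<in>carrier_vec n. x \<bullet> (S *\<^sub>v x) \<le> \<mu> * (x \<bullet> x))"
proof -
  have S': "- S \<in> carrier_mat n n" using S by simp
  have sym': "transpose_mat (- S) = - S"
    using S arg_cong[OF sym, of uminus] by (simp add: transpose_uminus)
  have neg: "(- S) *\<^sub>v x = - (S *\<^sub>v x)" if "x \<in> carrier_vec n" for x
    using S that by simp
  obtain \<mu> v where v: "eigenvector (- S) v \<mu>"
    and le: "\<And>x. x \<in> carrier_vec n \<Longrightarrow> \<mu> * (x \<bullet> x) \<le> x \<bullet> ((- S) *\<^sub>v x)"
    using symmetric_min_eigenvalue[OF S' sym' n] unfolding eigenvalue_def by blast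
  have vn: "v \<in> carrier_vec n" and "- (S *\<^sub>v v) = \<mu> \<cdot>\<^sub>v v"
    using v S neg[of v] unfolding eigenvector_def by auto
  then have "S *\<^sub>v v = - (\<mu> \<cdot>\<^sub>v v)"
    by (metis uminus_uminus_vec)
  also have "\<dots> = (- \<mu>) \<cdot>\<^sub>v v" by (rule eq_vecI) simp_all
  finally have "S *\<^sub>v v = (- \<mu>) \<cdot>\<^sub>v v" .
  then have "eigenvector S v (- \<mu>)" using v S unfolding eigenvector_def by simp
  moreover have "x \<bullet> (S *\<^sub>v x) \<le> - \<mu> * (x \<bullet> x)" if x: "x \<in> carrier_vec n" for x
    using le[OF x] S x neg[OF x] by simp
  ultimately show ?thesis unfolding eigenvalue_def by blast
qed

section \<open>Extreme singular values as Rayleigh quotients\<close>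

lemma gram_mat:
  assumes "D \<in> carrier_mat m n"
  shows "transpose_mat D * D \<in> carrier_mat n n"
    and "transpose_mat (transpose_mat D * (D :: real mat)) = transpose_mat D * D"
  using assms by (auto simp: transpose_mult[of _ n m _ n])

lemma scalar_prod_gram_mat:
  fixes D :: "real mat"
  assumes D: "D \<in> carrier_mat m n" and x: "x \<in> carrier_vec n"
  shows "x \<bullet> ((transpose_mat D * D) *\<^sub>v x) = (D *\<^sub>v x) \<bullet> (D *\<^sub>v x)"
proof -
  have Dx: "D *\<^sub>v x \<in> carrier_vec m" using D x by simp
  have "x \<bullet> ((transpose_mat D * D) *\<^sub>v x) = x \<bullet> (transpose_mat D *\<^sub>v (D *\<^sub>v x))"
    using D x by (simp add: assoc_mult_mat_vec[of _ n m _ n])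
  also have "\<dots> = (transpose_mat D *\<^sub>v (D *\<^sub>v x)) \<bullet> x"
    using D x by (intro comm_scalar_prod[of _ n]) auto
  also have "\<dots> = (D *\<^sub>v x) \<bullet> (D *\<^sub>v x)"
    using transpose_vec_mult_scalar[OF D x Dx] .
  finally show ?thesis .
qed

text \<open>An eigenvector \<open>v\<close> of the Gram matrix satisfies \<open>\<bar>D v\<bar>\<^sup>2 = \<mu> \<bar>v\<bar>\<^sup>2\<close>. This gives the sign of \<open>\<mu>\<close>, and
  a vector whose quotient \<open>\<bar>D v\<bar> / \<bar>v\<bar>\<close> is exactly the singular value \<open>sqrt \<mu>\<close>.\<close>

lemma eigenvalue_gram_mat:
  fixes D :: "real mat"
  assumes D: "D \<in> carrier_mat m n" and ev: "eigenvalue (transpose_mat D * D) \<mu>"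
  shows "0 \<le> \<mu>"
    and "\<exists>v\<in>carrier_vec n. v \<noteq> 0\<^sub>v n \<and> (D *\<^sub>v v) \<bullet> (D *\<^sub>v v) = \<mu> * (v \<bullet> v)"
proof -
  obtain v where v: "v \<in> carrier_vec n" "v \<noteq> 0\<^sub>v n"
    and eq: "(transpose_mat D * D) *\<^sub>v v = \<mu> \<cdot>\<^sub>v v"
    using ev gram_mat(1)[OF D] D unfolding eigenvalue_def eigenvector_def by auto
  have Dv: "(D *\<^sub>v v) \<bullet> (D *\<^sub>v v) = \<mu> * (v \<bullet> v)"
    using scalar_prod_gram_mat[OF D v(1)] v(1) unfolding eq by simp
  then show "\<exists>v\<in>carrier_vec n. v \<noteq> 0\<^sub>v n \<and> (D *\<^sub>v v) \<bullet> (D *\<^sub>v v) = \<mu> * (v \<bullet> v)"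
    using v by blast
  show "0 \<le> \<mu>"
    using Dv scalar_prod_self_nonneg[of "D *\<^sub>v v"] scalar_prod_self_pos[OF v]
    by (simp add: zero_le_mult_iff)
qed

text \<open>The length is the place where the splitting of the characteristic polynomial matters: roots that
  are not real would be missing from the list, and \<open>singular_value n D\<close> would not be its last entry.\<close>

lemma singular_values_spectrum:
  fixes D :: "real mat"
  assumes D: "D \<in> carrier_mat m n"
  shows "length (singular_values D) = n"
    and "set (singular_values D) = sqrt ` {\<mu>. eigenvalue (transpose_mat D * D) \<mu>}"
    and "sorted (rev (singular_values D))"
proof -
  let ?p = "char_poly (transpose_mat D * D)"
  note G = gram_mat[OF D]
  obtain as where as: "length as = n" "?p = (\<Prod>a\<leftarrow>as. [:- a, 1:])"
    using symmetric_char_poly_splits[OF G] by blast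
  have "proots (\<Prod>a\<leftarrow>as. [:- a, 1:]) = mset as"
  proof (induction as)
    case (Cons a as)
    have "(\<Prod>a\<leftarrow>as. [:- a, 1:]) \<noteq> 0" by (auto simp: prod_list_zero_iff)
    then have "proots (\<Prod>a\<leftarrow>a # as. [:- a, 1:]) = proots [:- a, 1:] + proots (\<Prod>a\<leftarrow>as. [:- a, 1:])"
      unfolding list.map prod_list.Cons by (intro proots_mult) auto
    then show ?case using Cons by simp
  qed simp
  moreover have "length (singular_values D) = size (proots ?p)"
    unfolding singular_values_def
    by (metis length_rev mset_sorted_list_of_multiset size_image_mset size_mset)
  ultimately show "length (singular_values D) = n" using as by simp
  have "?p \<noteq> 0" using as by (auto simp: prod_list_zero_iff)
  then show "set (singular_values D) = sqrt ` {\<mu>. eigenvalue (transpose_mat D * D) \<mu>}"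
    unfolding singular_values_def by (simp add: eigenvalue_root_char_poly[OF G(1)])
  show "sorted (rev (singular_values D))"
    unfolding singular_values_def by simp
qed

text \<open>The first entry of the list is an eigenvalue of the Gram matrix under the square root, which
  gives attainment; it dominates the largest eigenvalue, which gives the upper bound.\<close>

lemma first_singular_value_Rayleigh:
  fixes D :: "real mat"
  assumes D: "D \<in> carrier_mat m n" and n: "0 < n"
  shows "0 \<le> singular_value 1 D"
    and "\<And>x. x \<in> carrier_vec n \<Longrightarrow>
           (D *\<^sub>v x) \<bullet> (D *\<^sub>v x) \<le> (singular_value 1 D)\<^sup>2 * (x \<bullet> x)"
    and "\<exists>v\<in>carrier_vec n. v \<noteq> 0\<^sub>v n \<and>
           (D *\<^sub>v v) \<bullet> (D *\<^sub>v v) = (singular_value 1 D)\<^sup>2 * (v \<bullet> v)"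
proof -
  let ?s = "singular_values D" and ?G = "transpose_mat D * D"
  note S = singular_values_spectrum[OF D]
  have "singular_value 1 D \<in> set ?s"
    unfolding singular_value_def using n S(1) by simp
  then obtain \<mu> where ev: "eigenvalue ?G \<mu>" and sv: "singular_value 1 D = sqrt \<mu>"
    unfolding S(2) by blast
  have sq: "(singular_value 1 D)\<^sup>2 = \<mu>" using eigenvalue_gram_mat(1)[OF D ev] sv by simp
  show "0 \<le> singular_value 1 D" using eigenvalue_gram_mat(1)[OF D ev] sv by simp
  show "\<exists>v\<in>carrier_vec n. v \<noteq> 0\<^sub>v n \<and>
      (D *\<^sub>v v) \<bullet> (D *\<^sub>v v) = (singular_value 1 D)\<^sup>2 * (v \<bullet> v)"
    unfolding sq by (rule eigenvalue_gram_mat(2)[OF D ev])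
  obtain M where M: "eigenvalue ?G M"
    and le: "\<And>x. x \<in> carrier_vec n \<Longrightarrow> x \<bullet> (?G *\<^sub>v x) \<le> M * (x \<bullet> x)"
    using symmetric_max_eigenvalue[OF gram_mat[OF D] n] by blast
  have "sqrt M \<in> set ?s" unfolding S(2) using M by blast
  then obtain i where i: "i < n" "?s ! i = sqrt M" using S(1) by (auto simp: in_set_conv_nth)
  then have "sqrt M \<le> singular_value 1 D"
    using sorted_rev_nth_mono[OF S(3), of 0 i] S(1) by (simp add: singular_value_def)
  then have "M \<le> \<mu>" unfolding sv by simp
  show "(D *\<^sub>v x) \<bullet> (D *\<^sub>v x) \<le> (singular_value 1 D)\<^sup>2 * (x \<bullet> x)"
    if x: "x \<in> carrier_vec n" for x
    using le[OF x] mult_right_mono[OF \<open>M \<le> \<mu>\<close> scalar_prod_self_nonneg[of x]]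
    unfolding sq scalar_prod_gram_mat[OF D x] by linarith
qed

lemma last_singular_value_Rayleigh:
  fixes D :: "real mat"
  assumes D: "D \<in> carrier_mat m n" and n: "0 < n"
  shows "0 \<le> singular_value n D"
    and "\<And>x. x \<in> carrier_vec n \<Longrightarrow>
           (singular_value n D)\<^sup>2 * (x \<bullet> x) \<le> (D *\<^sub>v x) \<bullet> (D *\<^sub>v x)"
    and "\<exists>v\<in>carrier_vec n. v \<noteq> 0\<^sub>v n \<and>
           (D *\<^sub>v v) \<bullet> (D *\<^sub>v v) = (singular_value n D)\<^sup>2 * (v \<bullet> v)"
proof -
  let ?s = "singular_values D" and ?G = "transpose_mat D * D"
  note S = singular_values_spectrum[OF D]
  have "singular_value n D \<in> set ?s"
    unfolding singular_value_def using n S(1) by simp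
  then obtain \<mu> where ev: "eigenvalue ?G \<mu>" and sv: "singular_value n D = sqrt \<mu>"
    unfolding S(2) by blast
  have sq: "(singular_value n D)\<^sup>2 = \<mu>" using eigenvalue_gram_mat(1)[OF D ev] sv by simp
  show "0 \<le> singular_value n D" using eigenvalue_gram_mat(1)[OF D ev] sv by simp
  show "\<exists>v\<in>carrier_vec n. v \<noteq> 0\<^sub>v n \<and>
      (D *\<^sub>v v) \<bullet> (D *\<^sub>v v) = (singular_value n D)\<^sup>2 * (v \<bullet> v)"
    unfolding sq by (rule eigenvalue_gram_mat(2)[OF D ev])
  obtain M where M: "eigenvalue ?G M"
    and le: "\<And>x. x \<in> carrier_vec n \<Longrightarrow> M * (x \<bullet> x) \<le> x \<bullet> (?G *\<^sub>v x)"
    using symmetric_min_eigenvalue[OF gram_mat[OF D] n] by blast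
  have "sqrt M \<in> set ?s" unfolding S(2) using M by blast
  then obtain i where i: "i < n" "?s ! i = sqrt M" using S(1) by (auto simp: in_set_conv_nth)
  then have "singular_value n D \<le> sqrt M"
    using sorted_rev_nth_mono[OF S(3), of i "n - 1"] S(1) by (simp add: singular_value_def)
  then have "\<mu> \<le> M" unfolding sv by simp
  show "(singular_value n D)\<^sup>2 * (x \<bullet> x) \<le> (D *\<^sub>v x) \<bullet> (D *\<^sub>v x)"
    if x: "x \<in> carrier_vec n" for x
    using le[OF x] mult_right_mono[OF \<open>\<mu> \<le> M\<close> scalar_prod_self_nonneg[of x]]
    unfolding sq scalar_prod_gram_mat[OF D x] by linarith
qed

text \<open>If each \<open>x\<close> has a partner \<open>y\<close> of equal norm with \<open>\<bar>D x\<bar> \<le> \<bar>E y\<bar>\<close>, comparing at a maximizer for \<open>D\<close>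
  suffices. The partner is \<open>x\<close> itself when rows are deleted and the extension of \<open>x\<close> by zeros when
  columns are deleted.\<close>

lemma first_singular_value_mono:
  fixes D E :: "real mat"
  assumes D: "D \<in> carrier_mat m n" "0 < n" and E: "E \<in> carrier_mat m' n'" "0 < n'"
    and dom: "\<And>x. x \<in> carrier_vec n \<Longrightarrow>
      \<exists>y\<in>carrier_vec n'. y \<bullet> y = x \<bullet> x \<and> (D *\<^sub>v x) \<bullet> (D *\<^sub>v x) \<le> (E *\<^sub>v y) \<bullet> (E *\<^sub>v y)"
  shows "singular_value 1 D \<le> singular_value 1 E"
proof -
  obtain v where v: "v \<in> carrier_vec n" "v \<noteq> 0\<^sub>v n"
    and Dv: "(D *\<^sub>v v) \<bullet> (D *\<^sub>v v) = (singular_value 1 D)\<^sup>2 * (v \<bullet> v)"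
    using first_singular_value_Rayleigh(3)[OF D] by blast
  obtain y where y: "y \<in> carrier_vec n'" "y \<bullet> y = v \<bullet> v"
    and le: "(D *\<^sub>v v) \<bullet> (D *\<^sub>v v) \<le> (E *\<^sub>v y) \<bullet> (E *\<^sub>v y)"
    using dom[OF v(1)] by blast
  have "(singular_value 1 D)\<^sup>2 * (v \<bullet> v) \<le> (singular_value 1 E)\<^sup>2 * (v \<bullet> v)"
    using first_singular_value_Rayleigh(2)[OF E y(1)] le Dv y(2) by simp
  then have "(singular_value 1 D)\<^sup>2 \<le> (singular_value 1 E)\<^sup>2"
    using scalar_prod_self_pos[OF v] by simp
  then show ?thesis by (rule power2_le_imp_le) (rule first_singular_value_Rayleigh(1)[OF E])
qed

lemma last_singular_value_mono:
  fixes D E :: "real mat"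
  assumes D: "D \<in> carrier_mat m n" "0 < n" and E: "E \<in> carrier_mat m' n'" "0 < n'"
    and dom: "\<And>x. x \<in> carrier_vec n \<Longrightarrow>
      \<exists>y\<in>carrier_vec n'. y \<bullet> y = x \<bullet> x \<and> (E *\<^sub>v y) \<bullet> (E *\<^sub>v y) \<le> (D *\<^sub>v x) \<bullet> (D *\<^sub>v x)"
  shows "singular_value n' E \<le> singular_value n D"
proof -
  obtain v where v: "v \<in> carrier_vec n" "v \<noteq> 0\<^sub>v n"
    and Dv: "(D *\<^sub>v v) \<bullet> (D *\<^sub>v v) = (singular_value n D)\<^sup>2 * (v \<bullet> v)"
    using last_singular_value_Rayleigh(3)[OF D] by blast
  obtain y where y: "y \<in> carrier_vec n'" "y \<bullet> y = v \<bullet> v"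
    and le: "(E *\<^sub>v y) \<bullet> (E *\<^sub>v y) \<le> (D *\<^sub>v v) \<bullet> (D *\<^sub>v v)"
    using dom[OF v(1)] by blast
  have "(singular_value n' E)\<^sup>2 * (v \<bullet> v) \<le> (singular_value n D)\<^sup>2 * (v \<bullet> v)"
    using last_singular_value_Rayleigh(2)[OF E y(1)] le Dv y(2) by simp
  then have "(singular_value n' E)\<^sup>2 \<le> (singular_value n D)\<^sup>2"
    using scalar_prod_self_pos[OF v] by simp
  then show ?thesis by (rule power2_le_imp_le) (rule last_singular_value_Rayleigh(1)[OF D])
qed

lemma last_singular_value_pos:
  fixes D B :: "real mat"
  assumes D: "D \<in> carrier_mat m n" "0 < n" and B: "B \<in> carrier_mat n m" "B * D = 1\<^sub>m n"
  shows "0 < singular_value n D"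
proof -
  obtain v where v: "v \<in> carrier_vec n" "v \<noteq> 0\<^sub>v n"
    and Dv: "(D *\<^sub>v v) \<bullet> (D *\<^sub>v v) = (singular_value n D)\<^sup>2 * (v \<bullet> v)"
    using last_singular_value_Rayleigh(3)[OF D] by blast
  have "v = B *\<^sub>v (D *\<^sub>v v)"
    using B D v assoc_mult_mat_vec[OF B(1) D(1) v(1)] by simp
  then have "D *\<^sub>v v \<noteq> 0\<^sub>v m" using v(2) B by auto
  then have "0 < (D *\<^sub>v v) \<bullet> (D *\<^sub>v v)"
    using D v by (intro scalar_prod_self_pos[of _ m]) auto
  then have "singular_value n D \<noteq> 0" unfolding Dv by auto
  then show ?thesis using last_singular_value_Rayleigh(1)[OF D] by simp
qed

section \<open>Submatrices\<close>

lemma row_subselection_norm_le: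
  fixes A :: "real mat"
  assumes A: "A \<in> carrier_mat m n" and x: "x \<in> carrier_vec n"
    and inj: "inj_on \<pi> {..<k}" and range: "\<pi> ` {..<k} \<subseteq> {..<m}"
  shows "(row_subselection k \<pi> A *\<^sub>v x) \<bullet> (row_subselection k \<pi> A *\<^sub>v x) \<le> (A *\<^sub>v x) \<bullet> (A *\<^sub>v x)"
proof -
  let ?B = "row_subselection k \<pi> A"
  have "(?B *\<^sub>v x) $ i = (A *\<^sub>v x) $ \<pi> i" if "i < k" for i
  proof -
    have "\<pi> i < m" using that range by auto
    then have "Matrix.row ?B i = Matrix.row A (\<pi> i)"
      using A that by (intro eq_vecI) (auto simp: row_subselection_def)
    then show ?thesis using A that \<open>\<pi> i < m\<close> by (simp add: row_subselection_def)
  qed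
  moreover have "dim_row ?B = k" by (simp add: row_subselection_def)
  ultimately have "(?B *\<^sub>v x) \<bullet> (?B *\<^sub>v x) = (\<Sum>i<k. ((A *\<^sub>v x) $ \<pi> i)\<^sup>2)"
    by (auto simp: scalar_prod_def atLeast0LessThan power2_eq_square simp del: index_mult_mat_vec
        intro!: sum.cong)
  also have "\<dots> = (\<Sum>i\<in>\<pi> ` {..<k}. ((A *\<^sub>v x) $ i)\<^sup>2)"
    using sum.reindex[OF inj, of "\<lambda>i. ((A *\<^sub>v x) $ i)\<^sup>2"] by simp
  also have "\<dots> \<le> (\<Sum>i<m. ((A *\<^sub>v x) $ i)\<^sup>2)"
    using range by (intro sum_mono2) auto
  also have "\<dots> = (A *\<^sub>v x) \<bullet> (A *\<^sub>v x)"
    using A by (auto simp: scalar_prod_def atLeast0LessThan power2_eq_square simp del: index_mult_mat_vec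
        intro!: sum.cong)
  finally show ?thesis .
qed

lemma bij_betw_pick:
  assumes "finite C"
  shows "bij_betw (pick C) {..<card C} C"
proof -
  have inj: "inj_on (pick C) {..<card C}"
    by (intro inj_onI) (metis lessThan_iff nat_neq_iff pick_mono_le)
  have sub: "pick C ` {..<card C} \<subseteq> C" using pick_in_set_le by auto
  have "pick C ` {..<card C} = C"
    using card_image[OF inj] by (intro card_subset_eq[OF assms sub]) simp
  then show ?thesis using inj unfolding bij_betw_def by blast
qed

text \<open>The witness \<open>y\<close> is the extension of \<open>x\<close> by zeros outside the chosen columns \<open>C\<close>.\<close>

lemma submatrix_columns_mult_vec:
  fixes B :: "real mat"
  assumes B: "B \<in> carrier_mat m n" and C: "C \<subseteq> {..<n}" and x: "x \<in> carrier_vec (card C)"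
  shows "\<exists>y\<in>carrier_vec n. y \<bullet> y = x \<bullet> x \<and> submatrix B UNIV C *\<^sub>v x = B *\<^sub>v y"
proof -
  have fin: "finite C" using C finite_subset by blast
  let ?r = "the_inv_into {..<card C} (pick C)"
  define y where "y = Matrix.vec n (\<lambda>c. if c \<in> C then x $ ?r c else 0)"
  note bij = bij_betw_pick[OF fin]
  have y_pick: "y $ pick C j = x $ j" if "j < card C" for j
  proof -
    have "pick C j \<in> C" using pick_in_set_le[OF that] .
    moreover have "?r (pick C j) = j"
      using bij that unfolding bij_betw_def by (intro the_inv_into_f_f) auto
    ultimately show ?thesis using C by (auto simp: y_def)
  qed
  have sum_C: "(\<Sum>c<n. f c * y $ c) = (\<Sum>j<card C. f (pick C j) * x $ j)" for f :: "nat \<Rightarrow> real"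
  proof -
    have "(\<Sum>c<n. f c * y $ c) = (\<Sum>c\<in>C. f c * y $ c)"
      using C by (intro sum.mono_neutral_right) (auto simp: y_def)
    also have "\<dots> = (\<Sum>j<card C. f (pick C j) * y $ pick C j)"
      by (rule sum.reindex_bij_betw[OF bij, symmetric])
    finally show ?thesis by (simp add: y_pick)
  qed
  have yn: "y \<in> carrier_vec n" by (simp add: y_def)
  have Cn: "{c. c < n \<and> c \<in> C} = C" using C by auto
  have "y \<bullet> y = x \<bullet> x"
    using yn x sum_C[of "\<lambda>c. y $ c"] by (simp add: scalar_prod_def atLeast0LessThan y_pick)
  moreover have "submatrix B UNIV C *\<^sub>v x = B *\<^sub>v y"
  proof (rule eq_vecI)
    fix i assume "i < dim_vec (B *\<^sub>v y)"
    then have i: "i < m" using B by simp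
    have "(B *\<^sub>v y) $ i = (\<Sum>c<n. B $$ (i, c) * y $ c)"
      using B i yn by (simp add: scalar_prod_def atLeast0LessThan)
    also have "\<dots> = (\<Sum>j<card C. B $$ (i, pick C j) * x $ j)" by (rule sum_C)
    also have "\<dots> = (submatrix B UNIV C *\<^sub>v x) $ i"
      using B i x Cn
      by (simp add: submatrix_def scalar_prod_def atLeast0LessThan pick_UNIV)
    finally show "(submatrix B UNIV C *\<^sub>v x) $ i = (B *\<^sub>v y) $ i" by simp
  qed (use B in \<open>simp add: submatrix_def\<close>)
  ultimately show ?thesis using yn by blast
qed

section \<open>Pivoted QR factorizations\<close>

lemma similar_singular_values:
  assumes "similar_mat (transpose_mat D * D) (transpose_mat E * E)"
  shows "singular_values D = singular_values E"
  unfolding singular_values_def using char_poly_similar[OF assms] by simp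

lemma invertible_mat_obtain_inverse:
  fixes R :: "'a::semiring_1 mat"
  assumes R: "R \<in> carrier_mat n n" and inv: "invertible_mat R"
  obtains R' where "R' \<in> carrier_mat n n" "R * R' = 1\<^sub>m n" "R' * R = 1\<^sub>m n"
proof -
  obtain R' where "R * R' = 1\<^sub>m n" "R' * R = 1\<^sub>m (dim_row R')"
    using R inv unfolding invertible_mat_def inverts_mat_def by auto
  moreover from this have "dim_col R' = n" "dim_row R' = n"
    using R by (metis carrier_matD(2) index_mult_mat(3) index_one_mat(3))+
  ultimately show thesis by (intro that[of R']) auto
qed

text \<open>The two Gram matrices are conjugate: \<open>X X\<^sup>T = X (X\<^sup>T X) Y\<close>, where \<open>Y\<close> is the inverse of \<open>X\<close>.\<close>

lemma singular_values_transpose: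
  fixes X :: "real mat"
  assumes X: "X \<in> carrier_mat n n"
    and Y: "Y \<in> carrier_mat n n" "X * Y = 1\<^sub>m n" "Y * X = 1\<^sub>m n"
  shows "singular_values (transpose_mat X) = singular_values X"
proof (rule similar_singular_values)
  let ?G = "transpose_mat X * X"
  have Xt: "transpose_mat X \<in> carrier_mat n n" using X by simp
  have G: "?G \<in> carrier_mat n n" using Xt X by (rule mult_carrier_mat)
  have "?G * Y = transpose_mat X"
    using assoc_mult_mat[OF Xt X Y(1)] Y(2) right_mult_one_mat[OF Xt] by simp
  then have conj: "X * transpose_mat X = X * ?G * Y"
    using assoc_mult_mat[OF X G Y(1)] by simp
  have "similar_mat (X * transpose_mat X) ?G"
    by (rule similar_matI[OF _ Y(2,3) conj]) (use X Xt G Y(1) mult_carrier_mat[OF X Xt] in blast)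
  then show "similar_mat (transpose_mat (transpose_mat X) * transpose_mat X) ?G"
    unfolding transpose_transpose .
qed

lemma singular_values_orthogonal_mult:
  fixes Q R :: "real mat"
  assumes Q: "orthogonal_square_mat n Q" and R: "R \<in> carrier_mat n k"
  shows "singular_values (Q * R) = singular_values R"
proof -
  have Qc: "Q \<in> carrier_mat n n" and QtQ: "transpose_mat Q * Q = 1\<^sub>m n"
    using Q unfolding orthogonal_square_mat_def by auto
  have QR: "Q * R \<in> carrier_mat n k" using Qc R by (rule mult_carrier_mat)
  have "transpose_mat Q * (Q * R) = R"
    using assoc_mult_mat[of "transpose_mat Q" n n Q n R k] Qc R QtQ by simp
  then have "transpose_mat (Q * R) * (Q * R) = transpose_mat R * R"
    unfolding transpose_mult[OF Qc R] using QR Qc R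
    by (subst assoc_mult_mat[of _ k n _ n _ k]) auto
  then show ?thesis unfolding singular_values_def by simp
qed

lemma orthogonal_mult_inverse:
  fixes Q R :: "real mat"
  assumes Q: "orthogonal_square_mat n Q" and R: "R \<in> carrier_mat n n"
    and R': "R' \<in> carrier_mat n n" "R * R' = 1\<^sub>m n" "R' * R = 1\<^sub>m n"
  shows "(Q * R) * (R' * transpose_mat Q) = 1\<^sub>m n"
    and "(R' * transpose_mat Q) * (Q * R) = 1\<^sub>m n"
proof -
  have Qc: "Q \<in> carrier_mat n n" and QtQ: "transpose_mat Q * Q = 1\<^sub>m n"
    and QQt: "Q * transpose_mat Q = 1\<^sub>m n"
    using Q unfolding orthogonal_square_mat_def by auto
  have Qt: "transpose_mat Q \<in> carrier_mat n n" using Qc by simp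
  have "R * (R' * transpose_mat Q) = transpose_mat Q"
    using assoc_mult_mat[OF R R'(1) Qt] Qc R'(2) by simp
  then show "(Q * R) * (R' * transpose_mat Q) = 1\<^sub>m n"
    using assoc_mult_mat[OF Qc R mult_carrier_mat[OF R'(1) Qt]] QQt by simp
  have "transpose_mat Q * (Q * R) = R"
    using assoc_mult_mat[OF Qt Qc R] R QtQ by simp
  then show "(R' * transpose_mat Q) * (Q * R) = 1\<^sub>m n"
    using assoc_mult_mat[OF R'(1) Qt mult_carrier_mat[OF Qc R]] R'(3) by simp
qed

text \<open>If \<open>P\<close> is the matrix of the permutation \<open>p\<close>, with a one at \<open>(p j, j)\<close>, then \<open>\<pi> j = p j\<close>, and
  column \<open>j\<close> of \<open>A\<^sup>T P\<close> is row \<open>p j\<close> of \<open>A\<close>. The first \<open>n\<close> columns of \<open>Q (R1 R2)\<close> are \<open>Q R1\<close>.\<close>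

lemma row_subselection_pivoted_qr:
  fixes A :: "real mat"
  assumes A: "A \<in> carrier_mat m n" and "n \<le> m"
    and qr: "pivoted_qr m n A P Q R1 R2" and pv: "pivot_vector m P \<pi>"
  shows "row_subselection n \<pi> A = transpose_mat (Q * R1)"
    and "inj_on \<pi> {..<m}" and "\<pi> ` {..<m} \<subseteq> {..<m}"
proof -
  obtain p where p: "p permutes {..<m}"
    and P: "P = Matrix.mat m m (\<lambda>(i, j). if i = p j then 1 else 0)"
    using qr unfolding pivoted_qr_def permutation_matrix_def by blast
  have Q: "Q \<in> carrier_mat n n" and R1: "R1 \<in> carrier_mat n n" and R2: "R2 \<in> carrier_mat n (m - n)"
    and fac: "transpose_mat A * P = Q * append_cols R1 R2"
    using qr unfolding pivoted_qr_def orthogonal_square_mat_def by auto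
  have pm: "p j < m" if "j < m" for j
    using permutes_in_image[OF p, of j] that by simp
  have \<pi>: "\<pi> j = p j" if j: "j < m" for j
  proof -
    have "real (\<pi> j + 1) = (transpose_mat P *\<^sub>v Matrix.vec m (\<lambda>i. real (i + 1))) $ j"
      using pv j unfolding pivot_vector_def by simp
    also have "\<dots> = (\<Sum>i<m. if i = p j then real (i + 1) else 0)"
      using j unfolding P by (simp add: scalar_prod_def atLeast0LessThan mult_delta_left)
    also have "\<dots> = real (p j + 1)" using pm[OF j] by simp
    finally show ?thesis by simp
  qed
  show "inj_on \<pi> {..<m}"
    using permutes_inj_on[OF p, of "{..<m}"] inj_on_cong[of "{..<m}" \<pi> p] \<pi> by simp
  show "\<pi> ` {..<m} \<subseteq> {..<m}" using \<pi> pm by auto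
  show "row_subselection n \<pi> A = transpose_mat (Q * R1)"
  proof (rule eq_matI)
    fix i c assume "i < dim_row (transpose_mat (Q * R1))" "c < dim_col (transpose_mat (Q * R1))"
    then have i: "i < n" and c: "c < n" using Q R1 by auto
    have im: "i < m" using i \<open>n \<le> m\<close> by simp
    have "(transpose_mat A * P) $$ (c, i) = (\<Sum>k<m. if k = p i then A $$ (k, c) else 0)"
      using A i im c unfolding P by (simp add: scalar_prod_def atLeast0LessThan mult_delta_right)
    also have "\<dots> = A $$ (p i, c)" using pm[OF im] by simp
    finally have "row_subselection n \<pi> A $$ (i, c) = (transpose_mat A * P) $$ (c, i)"
      using A i c \<pi>[OF im] by (simp add: row_subselection_def)
    also have "\<dots> = (Q * append_cols R1 R2) $$ (c, i)" unfolding fac ..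
    also have "\<dots> = (Q * R1) $$ (c, i)"
      using Q R1 R2 i im c
      by (auto simp: append_cols_def scalar_prod_def four_block_mat_def Let_def intro!: sum.cong)
    also have "\<dots> = transpose_mat (Q * R1) $$ (i, c)" using Q R1 i c by simp
    finally show "row_subselection n \<pi> A $$ (i, c) = transpose_mat (Q * R1) $$ (i, c)" .
  qed (use A Q R1 in \<open>auto simp: row_subselection_def\<close>)
qed

theorem corollary1:
  fixes \<rho> :: "'d::finite \<Rightarrow> real \<Rightarrow> real"
    and \<psi> :: "'d \<Rightarrow> nat \<Rightarrow> real poly"
    and J I :: "('d \<Rightarrow> nat) set"
    and m n l :: nat
    and \<zeta> :: "nat \<Rightarrow> real ^ 'd"
    and \<omega> :: "nat \<Rightarrow> real"
    and e :: "nat \<Rightarrow> 'd \<Rightarrow> nat"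
    and A P Q R1 R2 A_box A_pruned :: "real mat"
    and \<pi> :: "nat \<Rightarrow> nat"
    and \<delta> :: real
  assumes "\<And>k. probability_density lborel (\<rho> k)"
    and "probability_density lborel (product_density \<rho>)"
    and "\<And>k. orthonormal_polys (\<rho> k) (\<psi> k)"
    and "admissible_index_set J" and "finite J" and "card J = n"
    and "tensor_quadrature m \<zeta> (\<lambda>i. (\<omega> i)\<^sup>2)" and "\<And>i. i < m \<Longrightarrow> 0 \<le> \<omega> i" and "m > n"
    and "\<And>j k. j \<in> J \<Longrightarrow> k \<in> J \<Longrightarrow>
           (\<Sum>i<m. (\<omega> i)\<^sup>2 * tensor_poly \<psi> j (\<zeta> i) * tensor_poly \<psi> k (\<zeta> i)) = (if k = j then 1 else 0)"
    and "bij_betw e {..<n} J"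
    and "A = design_matrix m n \<psi> \<zeta> \<omega> e"
    and "vec_space.rank m A = n"
    and "pivoted_qr m n A P Q R1 R2"
    and "pivot_vector m P \<pi>"
    and "A_box = row_subselection n \<pi> A"
    and "\<delta> > 1"
    and "\<And>i. 1 \<le> i \<Longrightarrow> i \<le> n \<Longrightarrow>
           singular_value i R1 \<ge> singular_value i A / sqrt (1 + \<delta>\<^sup>2 * real n * (real m - real n))"
    and "1 \<le> l" and "l \<le> n" and "I \<subseteq> J" and "card I = l"
    and "A_pruned = column_pruning e I A_box"
  shows "cond_number A_pruned \<le> cond_number A_box \<and>
         cond_number A_box \<le> cond_number A * sqrt (1 + \<delta>\<^sup>2 * real n * (real m - real n))"
proof -
  let ?s = "sqrt (1 + \<delta>\<^sup>2 * real n * (real m - real n))"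
  have A: "A \<in> carrier_mat m n" using assms(12) by (simp add: design_matrix_def)
  have n: "0 < n" using \<open>1 \<le> l\<close> \<open>l \<le> n\<close> by simp
  have s: "0 < ?s" using \<open>m > n\<close> by (intro real_sqrt_gt_zero add_pos_nonneg) auto
  have Q: "orthogonal_square_mat n Q" and R1: "R1 \<in> carrier_mat n n" and inv: "invertible_mat R1"
    using assms(14) unfolding pivoted_qr_def by auto
  have Qc: "Q \<in> carrier_mat n n" using Q unfolding orthogonal_square_mat_def by simp
  obtain R' where R': "R' \<in> carrier_mat n n" "R1 * R' = 1\<^sub>m n" "R' * R1 = 1\<^sub>m n"
    using invertible_mat_obtain_inverse[OF R1 inv] .
  note sub = row_subselection_pivoted_qr[OF A less_imp_le[OF \<open>m > n\<close>] assms(14,15), folded assms(16)]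
  have QR: "Q * R1 \<in> carrier_mat n n" and Y: "R' * transpose_mat Q \<in> carrier_mat n n"
    using Qc R1 R'(1) by auto
  have box: "A_box \<in> carrier_mat n n" unfolding sub(1) using QR by simp
  have "singular_values A_box = singular_values (Q * R1)"
    unfolding sub(1) by (rule singular_values_transpose[OF QR Y orthogonal_mult_inverse[OF Q R1 R']])
  then have sv: "singular_value i A_box = singular_value i R1" for i
    unfolding singular_value_def singular_values_orthogonal_mult[OF Q R1] by simp
  have le: "(A_box *\<^sub>v x) \<bullet> (A_box *\<^sub>v x) \<le> (A *\<^sub>v x) \<bullet> (A *\<^sub>v x)" if "x \<in> carrier_vec n" for x
  proof -
    have *: "{..<n} \<subseteq> {..<m}" using \<open>m > n\<close> by auto
    have "inj_on \<pi> {..<n}" by (rule inj_on_subset[OF sub(2) *])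
    moreover have "\<pi> ` {..<n} \<subseteq> {..<m}" by (rule order_trans[OF image_mono[OF *] sub(3)])
    ultimately show ?thesis unfolding assms(16) by (rule row_subselection_norm_le[OF A that])
  qed
  have first_A: "singular_value 1 A_box \<le> singular_value 1 A"
    by (rule first_singular_value_mono[OF box n A n]) (use le in blast)
  have last_A: "singular_value n A_box \<le> singular_value n A"
    by (rule last_singular_value_mono[OF A n box n]) (use le in blast)
  have pos: "0 < singular_value n A_box"
    unfolding sv using R1 n R' by (intro last_singular_value_pos[OF _ _ R'(1)])
  have bound: "singular_value n A / ?s \<le> singular_value n A_box"
    unfolding sv using assms(18)[of n] n by simp
  \<comment> \<open>The new denominator is positive, because \<open>last_A\<close> passes \<open>pos\<close> on to \<open>A\<close>.\<close>
  have "cond_number A_box \<le> singular_value 1 A / (singular_value n A / ?s)"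
    unfolding cond_number_def carrier_matD(2)[OF box]
    using first_A bound last_A pos s first_singular_value_Rayleigh(1)[OF A n]
    by (intro frac_le) auto
  then have "cond_number A_box \<le> cond_number A * ?s"
    unfolding cond_number_def carrier_matD(2)[OF A] by simp
  moreover have "cond_number A_pruned \<le> cond_number A_box"
  proof -
    define C where "C = {c. c < n \<and> e c \<in> I}"
    have pruned: "A_pruned = submatrix A_box UNIV C"
      unfolding assms(23) column_pruning_def C_def using box by simp
    have C: "C \<subseteq> {..<n}" by (auto simp: C_def)
    have "bij_betw e C I"
      using \<open>bij_betw e {..<n} J\<close> \<open>I \<subseteq> J\<close> unfolding bij_betw_def C_def
      by (auto intro: inj_on_subset)
    then have card: "card C = l" using \<open>card I = l\<close> bij_betw_same_card by blast
    have "{c. c < n \<and> c \<in> C} = C" using C by auto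
    then have Ap: "A_pruned \<in> carrier_mat n l"
      using box card unfolding pruned by (auto simp: submatrix_def)
    have l: "0 < l" using \<open>1 \<le> l\<close> by simp
    have ext: "\<exists>y\<in>carrier_vec n. y \<bullet> y = x \<bullet> x \<and> A_pruned *\<^sub>v x = A_box *\<^sub>v y"
      if "x \<in> carrier_vec l" for x
      using submatrix_columns_mult_vec[OF box C, of x] that unfolding card pruned by blast
    have first: "singular_value 1 A_pruned \<le> singular_value 1 A_box"
      by (rule first_singular_value_mono[OF Ap l box n]) (metis ext order_refl)
    have last: "singular_value n A_box \<le> singular_value l A_pruned"
      by (rule last_singular_value_mono[OF Ap l box n]) (metis ext order_refl)
    show ?thesis
      unfolding cond_number_def carrier_matD(2)[OF box] carrier_matD(2)[OF Ap]
      using first last pos first_singular_value_Rayleigh(1)[OF box n] by (intro frac_le) auto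
  qed
  ultimately show ?thesis by blast
qed

end
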